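(* Let $\mathcal{H}=\{G_1,\dots,G_k\}$ be a family of pairwise disjoint non-trivial connected graphs and let $G[\mathcal{H}]$ be a non-bipartite graph obtained by point-attaching from $\mathcal{H}$. If for each $j\in\{1,\dots,k\}$ every minimal (with respect to inclusion) local metric generator for $G_j$ is a minimum one (i.e. has cardinality $\dim_l(G_j)$), then $$\dim_l(G[\mathcal{H}])=\sum_{j\in J_{\mathcal{H}}}\bigl(\dim_l(G_j)-\alpha_j\bigr).$$
   Context: All graphs are finite, simple. For a connected graph $G$, $d_G(x,y)$ is the length of a shortest $x$–$y$ path. A set $W\subseteq V(G)$ is a local metric generator for $G$ if for every pair of adjacent vertices $u,v$ there is $w\in W$ with $d_G(u,w)\neq d_G(v,w)$. The local metric dimension $\dim_l(G)$ is the minimum cardinality of a local metric generator; a local metric generator of that cardinality is a local metric basis. Point-attaching: starting from $G_1$, for $i=1,\dots,k-1$, select a vertex of the already constructed graph and a vertex of $G_{i+1}$ and identify them; the result $G[\mathcal{H}]$ is obtained by point-attaching from $G_1,\dots,G_k$, and the $G_i$ (viewed as subgraphs of $G[\mathcal{H}]$) are its primary subgraphs. Attachment vertices are the vertices of $G[\mathcal{H}]$ obtained by identifying vertices of different primary subgraphs. For an attachment vertex $x$ and a primary subgraph $G_j$ with $x\in V(G_j)$, $G_j(x^+)$ is the connected component containing $x$ of the graph obtained from $G[\mathcal{H}]$ by removing all edges joining $x$ to vertices of $G_j$. $J_{\mathcal{H}}$ is the set of indices $j$ with $G_j$ not bipartite. For $j\in J_{\mathcal{H}}$, $C_j$ is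 the set of attachment vertices $x\in V(G_j)$ such that $G_j(x^+)$ is not bipartite, and $\alpha_j=\max\{|C_j\cap B| : B \text{ a local metric basis of } G_j\}$. *)

theory Defs
  imports "Graph_Theory.Digraph_Component"
begin

text \<open>
  A finite simple graph is a \<^typ>\<open>'a pair_pre_digraph\<close> satisfying the locale predicate
  \<^const>\<open>pair_graph\<close>: an undirected edge is represented by its two opposite arcs.
\<close>

definition graph_dist :: "'a pair_pre_digraph \<Rightarrow> 'a \<Rightarrow> 'a \<Rightarrow> nat" where
  "graph_dist G x y = (LEAST n. \<exists>p. pre_digraph.apath (with_proj G) x p y \<and> length p = n)"

definition bipartite :: "'a pair_pre_digraph \<Rightarrow> bool" where
  "bipartite G \<longleftrightarrow> (\<exists>A B. A \<union> B = pverts G \<and> A \<inter> B = {} \<and>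
     (\<forall>(u, v) \<in> parcs G. (u \<in> A \<and> v \<in> B) \<or> (u \<in> B \<and> v \<in> A)))"

definition local_metric_generator :: "'a pair_pre_digraph \<Rightarrow> 'a set \<Rightarrow> bool" where
  "local_metric_generator G W \<longleftrightarrow> W \<subseteq> pverts G \<and>
     (\<forall>(u, v) \<in> parcs G. \<exists>w \<in> W. graph_dist G u w \<noteq> graph_dist G v w)"

definition local_metric_dim :: "'a pair_pre_digraph \<Rightarrow> nat" where
  "local_metric_dim G = (LEAST n. \<exists>W. local_metric_generator G W \<and> card W = n)"

definition local_metric_basis :: "'a pair_pre_digraph \<Rightarrow> 'a set \<Rightarrow> bool" where
  "local_metric_basis G B \<longleftrightarrow> local_metric_generator G B \<and> card B = local_metric_dim G"

definition minimal_local_metric_generator :: "'a pair_pre_digraph \<Rightarrow> 'a set \<Rightarrow> bool" where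
  "minimal_local_metric_generator G W \<longleftrightarrow>
     local_metric_generator G W \<and> (\<forall>W'. W' \<subset> W \<longrightarrow> \<not> local_metric_generator G W')"

definition map_graph :: "('a \<Rightarrow> 'b) \<Rightarrow> 'a pair_pre_digraph \<Rightarrow> 'b pair_pre_digraph" where
  "map_graph f G = \<lparr>pverts = f ` pverts G, parcs = map_prod f f ` parcs G\<rparr>"

definition graph_union :: "'a pair_pre_digraph \<Rightarrow> 'a pair_pre_digraph \<Rightarrow> 'a pair_pre_digraph" where
  "graph_union G H = \<lparr>pverts = pverts G \<union> pverts H, parcs = parcs G \<union> parcs H\<rparr>"

text \<open>
  \<^term>\<open>point_attaching Gs G Ps\<close>: the graph \<open>G\<close> is obtained by point-attaching from the family
  \<open>Gs\<close> of graphs with pairwise disjoint vertex sets, and \<open>Ps ! j\<close> is the primary subgraph of \<open>G\<close>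
  that \<open>Gs ! j\<close> becomes.  Identifying the vertex \<open>v\<close> of the new graph \<open>H\<close> with the vertex \<open>u\<close> of
  the graph \<open>G\<close> built so far means taking the union after renaming \<open>v\<close> to \<open>u\<close> in \<open>H\<close>.
  Indices start at 0.
\<close>

inductive point_attaching ::
    "'a pair_pre_digraph list \<Rightarrow> 'a pair_pre_digraph \<Rightarrow> 'a pair_pre_digraph list \<Rightarrow> bool" where
  start: "point_attaching [G] G [G]"
| attach: "\<lbrakk>point_attaching Gs G Ps; u \<in> pverts G; v \<in> pverts H; H' = map_graph (id(v := u)) H\<rbrakk>
    \<Longrightarrow> point_attaching (Gs @ [H]) (graph_union G H') (Ps @ [H'])"

definition attachment_vertices :: "'a pair_pre_digraph list \<Rightarrow> 'a set" where
  "attachment_vertices Ps = {x. \<exists>i < length Ps. \<exists>j < length Ps.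
     i \<noteq> j \<and> x \<in> pverts (Ps ! i) \<and> x \<in> pverts (Ps ! j)}"

definition delete_edges_to :: "'a pair_pre_digraph \<Rightarrow> 'a \<Rightarrow> 'a set \<Rightarrow> 'a pair_pre_digraph" where
  "delete_edges_to G x S = \<lparr>pverts = pverts G, parcs = parcs G - ({x} \<times> S \<union> S \<times> {x})\<rparr>"

definition component_of :: "'a pair_pre_digraph \<Rightarrow> 'a \<Rightarrow> 'a pair_pre_digraph" where
  "component_of G x = (let S = {v. reachable (with_proj G) x v} in
     \<lparr>pverts = S, parcs = parcs G \<inter> S \<times> S\<rparr>)"

text \<open>The graph \<open>P(x\<^sup>+)\<close> for a primary subgraph \<open>P\<close> of \<open>G\<close>.\<close>

definition plus_component ::
    "'a pair_pre_digraph \<Rightarrow> 'a pair_pre_digraph \<Rightarrow> 'a \<Rightarrow> 'a pair_pre_digraph" where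
  "plus_component G P x = component_of (delete_edges_to G x (pverts P)) x"

definition J_set :: "'a pair_pre_digraph list \<Rightarrow> nat set" where
  "J_set Gs = {j. j < length Gs \<and> \<not> bipartite (Gs ! j)}"

definition C_set :: "'a pair_pre_digraph \<Rightarrow> 'a pair_pre_digraph list \<Rightarrow> nat \<Rightarrow> 'a set" where
  "C_set G Ps j = {x \<in> attachment_vertices Ps.
     x \<in> pverts (Ps ! j) \<and> \<not> bipartite (plus_component G (Ps ! j) x)}"

definition alpha :: "'a pair_pre_digraph \<Rightarrow> 'a pair_pre_digraph list \<Rightarrow> nat \<Rightarrow> nat" where
  "alpha G Ps j = Max {card (C_set G Ps j \<inter> B) |B. local_metric_basis (Ps ! j) B}"

end

theory Submission
  imports Defs
begin

text \<open>
  Every vertex \<open>w\<close> of \<open>G\<close> has a gate \<open>g\<^sub>j(w)\<close> in each primary subgraph \<open>P\<^sub>j\<close>: the vertex of \<open>P\<^sub>j\<close> through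
  which all walks from \<open>w\<close> to \<open>P\<^sub>j\<close> enter. Since \<open>d\<^sub>G(u, w) = d(u, g\<^sub>j(w)) + d\<^sub>G(g\<^sub>j(w), w)\<close> for \<open>u\<close> in
  \<open>P\<^sub>j\<close>, a set \<open>W\<close> is a local metric generator of \<open>G\<close> iff each \<open>g\<^sub>j(W)\<close> is one of \<open>P\<^sub>j\<close>, and \<open>P\<^sub>j(x\<^sup>+)\<close> is
  the subgraph induced by the fibre of \<open>g\<^sub>j\<close> over \<open>x\<close>.

  Lower bound: each \<open>g\<^sub>j(W)\<close> with \<open>P\<^sub>j\<close> not bipartite contains a basis \<open>B\<^sub>j\<close>, and preimages in \<open>W\<close> of
  the elements of the sets \<open>B\<^sub>j - C\<^sub>j\<close> are distinct, because for \<open>i \<noteq> j\<close> every vertex sees \<open>P\<^sub>i\<close> through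
  the gate of \<open>P\<^sub>j\<close> or vice versa. Upper bound: if the bases \<open>B\<^sub>j\<close> attain \<open>\<alpha>\<^sub>j\<close>, the union of the sets
  \<open>B\<^sub>j - C\<^sub>j\<close> is a generator, because it meets every non-bipartite \<open>P\<^sub>j(x\<^sup>+)\<close>: such a graph contains
  an outermost non-bipartite primary subgraph, whose basis has at least two elements, of which at
  most one lies in the corresponding \<open>C\<^sub>i\<close>.
\<close>

section \<open>Distances, bipartiteness and local metric generators\<close>

text \<open>The purely relational form of a finite simple connected graph: walks of length
  \<open>n\<close> become members of \<open>parcs G ^^ n\<close>, so walk arguments turn into
  inductions on relation powers.\<close>

definition connected_graph :: "'a pair_pre_digraph \<Rightarrow> bool" where
  "connected_graph G \<longleftrightarrow> finite (pverts G) \<and> pverts G \<noteq> {} \<and> parcs G \<subseteq> pverts G \<times> pverts G \<and>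
     sym (parcs G) \<and> irrefl (parcs G) \<and> (\<forall>x\<in>pverts G. \<forall>y\<in>pverts G. (x, y) \<in> (parcs G)\<^sup>*)"

lemma pair_graph_connected_graph:
  assumes "pair_graph G" and "Digraph_Component.connected (with_proj G)"
  shows "connected_graph G"
proof -
  interpret pair_graph G by fact
  have s: "sym (parcs G)"
    using pair_sym_arcs unfolding symmetric_def by simp
  \<comment> \<open>Connectedness of a digraph refers to the symmetric closure, which adds no arcs
    here.\<close>
  have "(parcs G)\<^sup>s = parcs G"
    using s by (auto simp: symcl_def sym_def)
  then have "pverts G \<noteq> {} \<and> (\<forall>u\<in>pverts G. \<forall>v\<in>pverts G. (u, v) \<in> rtrancl_on (pverts G) (parcs G))"
    using assms(2) by (simp add: connected_conv[of "with_proj G"])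
  then show ?thesis
    unfolding connected_graph_def using s pair_finite_verts
    by (auto dest: in_arcsD1 in_arcsD2 no_loops' rtrancl_on_rtranclI simp: irrefl_def)
qed

context
  fixes G :: "'a pair_pre_digraph"
  assumes G: "connected_graph G"
begin

lemma finite_pverts: "finite (pverts G)"
  using G by (simp add: connected_graph_def)

lemma arc_verts: "(a, b) \<in> parcs G \<Longrightarrow> a \<in> pverts G \<and> b \<in> pverts G"
  using G by (auto simp: connected_graph_def)

lemma arc_sym: "(a, b) \<in> parcs G \<Longrightarrow> (b, a) \<in> parcs G"
  using G by (auto simp: connected_graph_def sym_def)

lemma arc_neq: "(a, b) \<in> parcs G \<Longrightarrow> a \<noteq> b"
  using G by (auto simp: connected_graph_def irrefl_def)

lemma pverts_nonempty: "pverts G \<noteq> {}"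
  using G by (simp add: connected_graph_def)

lemma walk_exists: "x \<in> pverts G \<Longrightarrow> y \<in> pverts G \<Longrightarrow> (x, y) \<in> (parcs G)\<^sup>*"
  using G by (simp add: connected_graph_def)

lemma wf_digraph_with_proj: "wf_digraph (with_proj G)"
  by unfold_locales (auto dest: arc_verts)

section \<open>Distances as lengths of shortest walks\<close>

lemma awalk_imp_relpow:
  "pre_digraph.awalk (with_proj G) x p y \<Longrightarrow> (x, y) \<in> parcs G ^^ length p"
proof (induction p arbitrary: x)
  case Nil
  then show ?case by (simp add: wf_digraph.awalk_Nil_iff[OF wf_digraph_with_proj])
next
  case (Cons e p)
  then have "e \<in> parcs G" "x = fst e" "(snd e, y) \<in> parcs G ^^ length p"
    by (auto simp: wf_digraph.awalk_Cons_iff[OF wf_digraph_with_proj])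
  then show ?case
    by (metis length_Cons prod.collapse relpow_Suc_I2)
qed

lemma relpow_imp_awalk:
  "\<lbrakk>(x, y) \<in> parcs G ^^ n; x \<in> pverts G\<rbrakk>
    \<Longrightarrow> \<exists>p. pre_digraph.awalk (with_proj G) x p y \<and> length p = n"
proof (induction n arbitrary: x)
  case 0
  then show ?case by (auto simp: wf_digraph.awalk_Nil_iff[OF wf_digraph_with_proj])
next
  case (Suc n)
  then obtain z where z: "(x, z) \<in> parcs G" "(z, y) \<in> parcs G ^^ n"
    by (meson relpow_Suc_D2)
  then obtain p where "pre_digraph.awalk (with_proj G) z p y" "length p = n"
    using Suc.IH arc_verts by blast
  then show ?case
    using z by (intro exI[of _ "(x, z) # p"])
      (auto simp: wf_digraph.awalk_Cons_iff[OF wf_digraph_with_proj])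
qed

text \<open>Cutting out the closed part between two visits of a vertex strictly shortens the walk,
  so induction on the length ends at a path.\<close>

lemma awalk_shorten_apath:
  "pre_digraph.awalk (with_proj G) x p y
    \<Longrightarrow> \<exists>q. pre_digraph.apath (with_proj G) x q y \<and> length q \<le> length p"
proof (induction p rule: length_induct)
  case (1 p)
  show ?case
  proof (cases "distinct (pre_digraph.awalk_verts (with_proj G) x p)")
    case True
    then show ?thesis
      using "1.prems" by (auto simp: pre_digraph.apath_def)
  next
    case False
    then obtain q r s w where "p = q @ r @ s" "0 < length r"
      "pre_digraph.awalk (with_proj G) x q w" "pre_digraph.awalk (with_proj G) w s y"
      using wf_digraph.awalk_not_distinct_decomp[OF wf_digraph_with_proj "1.prems"] by blast
    then have "pre_digraph.awalk (with_proj G) x (q @ s) y" "length (q @ s) < length p"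
      using wf_digraph.awalk_appendI[OF wf_digraph_with_proj] by auto
    then show ?thesis
      using "1.IH" by (meson le_trans less_imp_le)
  qed
qed

text \<open>Walks shorten to paths, so the least length of a path is also the least length of a
  walk. All later arguments about \<open>graph_dist\<close> rest on these two facts.\<close>

lemma graph_dist_relpow:
  assumes "x \<in> pverts G" "y \<in> pverts G"
  shows "(x, y) \<in> parcs G ^^ graph_dist G x y"
    and "(x, y) \<in> parcs G ^^ n \<Longrightarrow> graph_dist G x y \<le> n"
proof -
  have le: "\<exists>p. pre_digraph.apath (with_proj G) x p y \<and> length p \<le> n" if "(x, y) \<in> parcs G ^^ n" for n
    using relpow_imp_awalk[OF that assms(1)] awalk_shorten_apath by blast
  obtain l where "(x, y) \<in> parcs G ^^ l"
    using walk_exists[OF assms] rtrancl_imp_relpow by metis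
  then obtain m where "\<exists>p. pre_digraph.apath (with_proj G) x p y \<and> length p = m"
    using le by blast
  from LeastI[of "\<lambda>n. \<exists>p. pre_digraph.apath (with_proj G) x p y \<and> length p = n", OF this]
  obtain p where "pre_digraph.apath (with_proj G) x p y" "length p = graph_dist G x y"
    unfolding graph_dist_def by blast
  then show "(x, y) \<in> parcs G ^^ graph_dist G x y"
    by (metis awalk_imp_relpow pre_digraph.awalkI_apath)
  show "graph_dist G x y \<le> n" if "(x, y) \<in> parcs G ^^ n"
    using le[OF that] unfolding graph_dist_def by (blast intro: Least_le le_trans)
qed

lemma graph_dist_self: "x \<in> pverts G \<Longrightarrow> graph_dist G x x = 0"
  using graph_dist_relpow(2)[of x x 0] by simp

lemma graph_dist_eq_0: "\<lbrakk>x \<in> pverts G; y \<in> pverts G; graph_dist G x y = 0\<rbrakk> \<Longrightarrow> x = y"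
  using graph_dist_relpow(1)[of x y] by simp

lemma graph_dist_triangle:
  "\<lbrakk>x \<in> pverts G; y \<in> pverts G; z \<in> pverts G\<rbrakk>
    \<Longrightarrow> graph_dist G x z \<le> graph_dist G x y + graph_dist G y z"
  using graph_dist_relpow(1)[of x y] graph_dist_relpow(1)[of y z]
  by (intro graph_dist_relpow(2)) (auto simp: relpow_add)

lemma graph_dist_arc:
  assumes "(a, b) \<in> parcs G" "y \<in> pverts G"
  shows "graph_dist G a y \<le> Suc (graph_dist G b y)"
proof -
  have "(b, y) \<in> parcs G ^^ graph_dist G b y"
    using assms arc_verts graph_dist_relpow(1) by blast
  then have "(a, y) \<in> parcs G ^^ Suc (graph_dist G b y)"
    using assms(1) relpow_Suc_I2 by metis
  then show ?thesis
    using assms arc_verts graph_dist_relpow(2) by blast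
qed

section \<open>Bipartiteness and the parity of distances\<close>

text \<open>A walk changes sides at every step, so the parity of its length tells whether its ends
  lie on the same side; \<open>a\<close> and \<open>b\<close> lie on opposite sides.\<close>

lemma bipartite_dist_parity:
  assumes "bipartite G" "(a, b) \<in> parcs G" "y \<in> pverts G"
  shows "even (graph_dist G a y) \<longleftrightarrow> odd (graph_dist G b y)"
proof -
  obtain A B where "A \<inter> B = {}" "\<forall>(u, v)\<in>parcs G. (u \<in> A \<and> v \<in> B) \<or> (u \<in> B \<and> v \<in> A)"
    using assms(1) unfolding bipartite_def by auto
  then have A: "u \<in> A \<longleftrightarrow> v \<notin> A" if "(u, v) \<in> parcs G" for u v
    using that by fast
  have walk: "(u, v) \<in> parcs G ^^ n \<Longrightarrow> (u \<in> A \<longleftrightarrow> v \<in> A) \<longleftrightarrow> even n" for n u v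
  proof (induction n arbitrary: v)
    case (Suc n)
    then obtain z where "(u, z) \<in> parcs G ^^ n" "(z, v) \<in> parcs G"
      by auto
    then show ?case using Suc.IH A[of z v] by (metis even_Suc)
  qed simp
  have "(a, y) \<in> parcs G ^^ graph_dist G a y" "(b, y) \<in> parcs G ^^ graph_dist G b y"
    using assms arc_verts graph_dist_relpow(1) by blast+
  then show ?thesis using walk A[OF assms(2)] by metis
qed

text \<open>Distances from adjacent vertices to \<open>y\<close> differ by at most one. If they
  always differ, they have opposite parity, and the two parity classes form a bipartition.\<close>

lemma bipartite_if_resolving_vertex:
  assumes "y \<in> pverts G" and "\<forall>(u, v)\<in>parcs G. graph_dist G u y \<noteq> graph_dist G v y"
  shows "bipartite G"
proof -
  have "even (graph_dist G u y) \<longleftrightarrow> odd (graph_dist G v y)" if "(u, v) \<in> parcs G" for u v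
  proof -
    have "graph_dist G u y \<le> Suc (graph_dist G v y)" "graph_dist G v y \<le> Suc (graph_dist G u y)"
      "graph_dist G u y \<noteq> graph_dist G v y"
      using that arc_sym graph_dist_arc assms by blast+
    then have "graph_dist G u y = Suc (graph_dist G v y) \<or> graph_dist G v y = Suc (graph_dist G u y)"
      by linarith
    then show ?thesis by (metis even_Suc)
  qed
  then show ?thesis
    unfolding bipartite_def using arc_verts
    by (intro exI[of _ "{v \<in> pverts G. even (graph_dist G v y)}"]
        exI[of _ "{v \<in> pverts G. odd (graph_dist G v y)}"]) auto
qed

text \<open>Expresses bipartiteness through distances alone, so that it transfers along renamings
  that preserve distances.\<close>

lemma bipartite_iff_resolving_vertex:
  assumes "y \<in> pverts G"
  shows "bipartite G \<longleftrightarrow> (\<forall>(u, v)\<in>parcs G. graph_dist G u y \<noteq> graph_dist G v y)"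
  using bipartite_if_resolving_vertex[OF assms] bipartite_dist_parity[OF _ _ assms] by force

section \<open>Existence and size of local metric generators\<close>

text \<open>Each edge is resolved by one of its own ends. Hence the minimum in
  \<open>local_metric_dim\<close> is attained.\<close>

lemma local_metric_generator_pverts: "local_metric_generator G (pverts G)"
  unfolding local_metric_generator_def
proof safe
  fix u v
  assume "(u, v) \<in> parcs G"
  then have "u \<in> pverts G" "v \<in> pverts G" "u \<noteq> v"
    using arc_verts arc_neq by blast+
  then show "\<exists>w\<in>pverts G. graph_dist G u w \<noteq> graph_dist G v w"
    using graph_dist_self graph_dist_eq_0 by (metis (full_types))
qed

lemma local_metric_dim_le: "local_metric_generator G W \<Longrightarrow> local_metric_dim G \<le> card W"
  unfolding local_metric_dim_def by (rule Least_le) blast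

lemma local_metric_basis_exists: "\<exists>B. local_metric_basis G B"
  using LeastI[of "\<lambda>n. \<exists>W. local_metric_generator G W \<and> card W = n"] local_metric_generator_pverts
  unfolding local_metric_basis_def local_metric_dim_def by blast

lemma local_metric_generator_finite: "local_metric_generator G W \<Longrightarrow> finite W"
  unfolding local_metric_generator_def using finite_pverts finite_subset by blast

text \<open>Otherwise a single vertex would resolve all edges, and its distance parities would give
  a bipartition.\<close>

lemma not_bipartite_generator_not_singleton:
  assumes "\<not> bipartite G" "local_metric_generator G W"
  shows "\<not> W \<subseteq> {y}"
proof
  assume "W \<subseteq> {y}"
  \<comment> \<open>When \<open>W\<close> is empty, \<open>y\<close> may lie outside the graph; an
    actual vertex \<open>z\<close> takes its place.\<close>
  obtain z where z: "z \<in> pverts G" "W \<subseteq> {z}"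
  proof (cases "W = {}")
    case True
    then show ?thesis using pverts_nonempty that by blast
  next
    case False
    then show ?thesis
      using that \<open>W \<subseteq> {y}\<close> assms(2) unfolding local_metric_generator_def by blast
  qed
  then have "\<forall>(u, v)\<in>parcs G. graph_dist G u z \<noteq> graph_dist G v z"
    using assms(2) unfolding local_metric_generator_def by blast
  then show False using bipartite_if_resolving_vertex z assms(1) by blast
qed

lemma minimal_generator_exists:
  assumes "local_metric_generator G W"
  obtains W' where "W' \<subseteq> W" "minimal_local_metric_generator G W'"
proof -
  have "finite {W'. W' \<subseteq> W \<and> local_metric_generator G W'}"
    using assms local_metric_generator_finite by simp
  moreover have "W \<in> {W'. W' \<subseteq> W \<and> local_metric_generator G W'}"
    using assms by simp
  ultimately obtain M where "M \<in> {W'. W' \<subseteq> W \<and> local_metric_generator G W'}"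
    "\<forall>W'\<in>{W'. W' \<subseteq> W \<and> local_metric_generator G W'}. W' \<subseteq> M \<longrightarrow> M = W'"
    by (meson finite_has_minimal2)
  then show ?thesis
    by (intro that[of M]) (auto simp: minimal_local_metric_generator_def)
qed

end

lemma local_metric_generator_superset:
  assumes "local_metric_generator G B" "B \<subseteq> W" "W \<subseteq> pverts G"
  shows "local_metric_generator G W"
  unfolding local_metric_generator_def
proof (intro conjI ballI, fact assms(3), clarify)
  fix u v
  assume "(u, v) \<in> parcs G"
  then obtain w where "w \<in> B" "graph_dist G u w \<noteq> graph_dist G v w"
    using assms(1) by (auto simp: local_metric_generator_def)
  then show "\<exists>w\<in>W. graph_dist G u w \<noteq> graph_dist G v w"
    using assms(2) by blast
qed

lemma relpow_mono_rel:
  fixes R S :: "'a rel"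
  assumes "R \<subseteq> S"
  shows "R ^^ n \<subseteq> S ^^ n"
  by (induction n) (use assms in auto)

section \<open>Gates\<close>

text \<open>
  \<open>g j\<close> assigns to each vertex of \<open>G\<close> its gate in \<open>Ps ! j\<close>. The last assumption encodes the tree-like
  arrangement of the primary subgraphs: \<open>Ps ! i\<close> is seen from \<open>Ps ! j\<close> through a single vertex.
\<close>

locale gated_union =
  fixes G :: "'a pair_pre_digraph" and Ps :: "'a pair_pre_digraph list" and g :: "nat \<Rightarrow> 'a \<Rightarrow> 'a"
  assumes connected: "connected_graph G"
    and primary: "j < length Ps \<Longrightarrow> connected_graph (Ps ! j)"
    and pverts_eq: "pverts G = (\<Union>j<length Ps. pverts (Ps ! j))"
    and parcs_eq: "parcs G = (\<Union>j<length Ps. parcs (Ps ! j))"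
    and gate_mem: "\<lbrakk>j < length Ps; w \<in> pverts G\<rbrakk> \<Longrightarrow> g j w \<in> pverts (Ps ! j)"
    and gate_id: "\<lbrakk>j < length Ps; w \<in> pverts (Ps ! j)\<rbrakk> \<Longrightarrow> g j w = w"
    and gate_arc: "\<lbrakk>i < length Ps; j < length Ps; i \<noteq> j; (a, b) \<in> parcs (Ps ! i)\<rbrakk> \<Longrightarrow> g j a = g j b"
begin

definition fibre :: "nat \<Rightarrow> 'a \<Rightarrow> 'a set" where
  "fibre j x = {w \<in> pverts G. g j w = x}"

lemma primary_verts: "j < length Ps \<Longrightarrow> a \<in> pverts (Ps ! j) \<Longrightarrow> a \<in> pverts G"
  using pverts_eq by auto

lemma primary_arcs: "j < length Ps \<Longrightarrow> parcs (Ps ! j) \<subseteq> parcs G"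
  using parcs_eq by auto

lemma arc_primary:
  assumes "(a, b) \<in> parcs G"
  obtains i where "i < length Ps" "(a, b) \<in> parcs (Ps ! i)" "a \<in> pverts (Ps ! i)" "b \<in> pverts (Ps ! i)"
proof -
  obtain i where "i < length Ps" "(a, b) \<in> parcs (Ps ! i)"
    using assms parcs_eq by auto
  then show ?thesis using that arc_verts[OF primary] by blast
qed

text \<open>The ends of an arc of another primary subgraph share their gate in
  \<open>Ps ! j\<close>, but vertices of \<open>Ps ! j\<close> are their own gates. So primary
  subgraphs are induced.\<close>

lemma arc_within_primary:
  assumes "j < length Ps" "(a, b) \<in> parcs G" "a \<in> pverts (Ps ! j)" "b \<in> pverts (Ps ! j)"
  shows "(a, b) \<in> parcs (Ps ! j)"
proof -
  obtain i where i: "i < length Ps" "(a, b) \<in> parcs (Ps ! i)"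
    using assms(2) by (rule arc_primary)
  have "a \<noteq> b" using arc_neq[OF connected assms(2)] .
  then have "i = j"
    using gate_arc[OF i(1) assms(1) _ i(2)] gate_id[OF assms(1,3)] gate_id[OF assms(1,4)] by auto
  then show ?thesis using i by simp
qed

lemma gate_const:
  assumes "i < length Ps" "j < length Ps" "i \<noteq> j" "a \<in> pverts (Ps ! i)" "b \<in> pverts (Ps ! i)"
  shows "g j a = g j b"
proof -
  have "(a, b) \<in> (parcs (Ps ! i))\<^sup>*"
    using walk_exists[OF primary[OF assms(1)] assms(4,5)] .
  then show ?thesis
    by (induction rule: rtrancl_induct) (use gate_arc[OF assms(1-3)] in auto)
qed

section \<open>Distances and generators seen through gates\<close>

text \<open>The walk is replaced by a walk in \<open>Ps ! j\<close> to the current gate, followed by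
  an excursion. An arc of \<open>Ps ! j\<close> starts at its own gate, so it prolongs the first
  piece and the excursion is discarded; any other arc keeps the gate and prolongs the
  excursion.\<close>

lemma walk_through_gate:
  assumes "j < length Ps" "u \<in> pverts (Ps ! j)"
  shows "(u, w) \<in> parcs G ^^ n
    \<Longrightarrow> \<exists>m l. (u, g j w) \<in> parcs (Ps ! j) ^^ m \<and> (g j w, w) \<in> parcs G ^^ l \<and> m + l \<le> n"
proof (induction n arbitrary: w)
  case 0
  then show ?case using assms gate_id by auto
next
  case (Suc n)
  then obtain z where z: "(u, z) \<in> parcs G ^^ n" "(z, w) \<in> parcs G"
    by auto
  then obtain m l where ml: "(u, g j z) \<in> parcs (Ps ! j) ^^ m" "(g j z, z) \<in> parcs G ^^ l" "m + l \<le> n"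
    using Suc.IH by blast
  obtain i where i: "i < length Ps" "(z, w) \<in> parcs (Ps ! i)"
    "z \<in> pverts (Ps ! i)" "w \<in> pverts (Ps ! i)"
    using z(2) by (rule arc_primary)
  show ?case
  proof (cases "i = j")
    case True
    then have "(u, g j w) \<in> parcs (Ps ! j) ^^ Suc m" "(g j w, w) \<in> parcs G ^^ 0"
      using i ml(1) gate_id assms(1) by auto
    then show ?thesis using ml(3) by (intro exI[of _ "Suc m"] exI[of _ 0]) auto
  next
    case False
    then have "g j w = g j z"
      using gate_arc[OF i(1) assms(1)] i(2) by simp
    then have "(u, g j w) \<in> parcs (Ps ! j) ^^ m" "(g j w, w) \<in> parcs G ^^ Suc l"
      using ml z(2) by auto
    then show ?thesis using ml(3) by (intro exI[of _ m] exI[of _ "Suc l"]) auto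
  qed
qed

text \<open>The triangle inequality gives one direction, splitting a shortest walk at the gate the
  other. The point is that the second summand does not depend on \<open>u\<close>.\<close>

lemma dist_through_gate:
  assumes "j < length Ps" "u \<in> pverts (Ps ! j)" "w \<in> pverts G"
  shows "graph_dist G u w = graph_dist (Ps ! j) u (g j w) + graph_dist G (g j w) w"
proof (rule antisym)
  note P = primary[OF assms(1)]
  have u: "u \<in> pverts G"
    using primary_verts[OF assms(1,2)] .
  have gw: "g j w \<in> pverts (Ps ! j)" "g j w \<in> pverts G"
    using gate_mem[OF assms(1,3)] primary_verts[OF assms(1)] by simp_all
  have "(u, g j w) \<in> parcs G ^^ graph_dist (Ps ! j) u (g j w)"
    using graph_dist_relpow(1)[OF P assms(2) gw(1)] relpow_mono_rel[OF primary_arcs[OF assms(1)]] by blast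
  then have "graph_dist G u (g j w) \<le> graph_dist (Ps ! j) u (g j w)"
    by (rule graph_dist_relpow(2)[OF connected u gw(2)])
  then show "graph_dist G u w \<le> graph_dist (Ps ! j) u (g j w) + graph_dist G (g j w) w"
    using graph_dist_triangle[OF connected u gw(2) assms(3)] by linarith
  obtain m l where "(u, g j w) \<in> parcs (Ps ! j) ^^ m" "(g j w, w) \<in> parcs G ^^ l"
    "m + l \<le> graph_dist G u w"
    using walk_through_gate[OF assms(1,2) graph_dist_relpow(1)[OF connected u assms(3)]] by blast
  then show "graph_dist (Ps ! j) u (g j w) + graph_dist G (g j w) w \<le> graph_dist G u w"
    using graph_dist_relpow(2)[OF P assms(2) gw(1)] graph_dist_relpow(2)[OF connected gw(2) assms(3)]
    by (meson add_mono le_trans)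
qed

lemma generator_iff_gates:
  assumes "W \<subseteq> pverts G"
  shows "local_metric_generator G W \<longleftrightarrow> (\<forall>j<length Ps. local_metric_generator (Ps ! j) (g j ` W))"
proof -
  \<comment> \<open>The summand \<open>graph_dist G (g j w) w\<close> is common to both sides and
    cancels.\<close>
  have eq: "graph_dist G a w = graph_dist G b w
      \<longleftrightarrow> graph_dist (Ps ! j) a (g j w) = graph_dist (Ps ! j) b (g j w)"
    if "j < length Ps" "(a, b) \<in> parcs (Ps ! j)" "w \<in> W" for j a b w
  proof -
    have "a \<in> pverts (Ps ! j)" "b \<in> pverts (Ps ! j)" "w \<in> pverts G"
      using that assms arc_verts[OF primary[OF that(1)]] by auto
    then show ?thesis using dist_through_gate that(1) by simp
  qed
  have "local_metric_generator G W \<longleftrightarrow>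
      (\<forall>j<length Ps. \<forall>(a, b)\<in>parcs (Ps ! j). \<exists>w\<in>W. graph_dist G a w \<noteq> graph_dist G b w)"
    unfolding local_metric_generator_def parcs_eq using assms by blast
  also have "\<dots> \<longleftrightarrow> (\<forall>j<length Ps. \<forall>(a, b)\<in>parcs (Ps ! j).
      \<exists>w\<in>W. graph_dist (Ps ! j) a (g j w) \<noteq> graph_dist (Ps ! j) b (g j w))"
    using eq by fast
  also have "\<dots> \<longleftrightarrow> (\<forall>j<length Ps. local_metric_generator (Ps ! j) (g j ` W))"
    unfolding local_metric_generator_def using gate_mem assms by fastforce
  finally show ?thesis .
qed

section \<open>The graphs \<open>plus_component\<close> as fibres of gates\<close>

text \<open>Follow a walk from \<open>Ps ! j\<close> to \<open>w\<close>: after an arc of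
  \<open>Ps ! j\<close> the current vertex is its own gate and the claim is trivial; any other arc
  keeps the gate and prolongs the walk already found.\<close>

lemma gate_connected_avoiding_primary:
  assumes j: "j < length Ps" and w: "w \<in> pverts G"
  shows "(g j w, w) \<in> (parcs G - parcs (Ps ! j))\<^sup>*"
proof -
  obtain u where u: "u \<in> pverts (Ps ! j)"
    using pverts_nonempty[OF primary[OF j]] by blast
  then have "(u, w) \<in> (parcs G)\<^sup>*"
    using walk_exists[OF connected _ w] primary_verts[OF j] by simp
  then show ?thesis
  proof (induction rule: rtrancl_induct)
    case base
    then show ?case using gate_id j u by simp
  next
    case (step y z)
    obtain i where i: "i < length Ps" "(y, z) \<in> parcs (Ps ! i)"
      "y \<in> pverts (Ps ! i)" "z \<in> pverts (Ps ! i)"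
      using step.hyps(2) by (rule arc_primary)
    show ?case
    proof (cases "(y, z) \<in> parcs (Ps ! j)")
      case True
      then show ?thesis using gate_id j arc_verts[OF primary[OF j]] by auto
    next
      case False
      then have "i \<noteq> j" using i by blast
      then have "g j y = g j z" using gate_arc i j by blast
      then show ?thesis using False step by (metis DiffI rtrancl.rtrancl_into_rtrancl)
    qed
  qed
qed

lemma plus_component_eq:
  assumes j: "j < length Ps" and x: "x \<in> pverts (Ps ! j)"
  shows "plus_component G (Ps ! j) x = \<lparr>pverts = fibre j x, parcs = parcs G \<inter> fibre j x \<times> fibre j x\<rparr>"
proof -
  define D where "D = delete_edges_to G x (pverts (Ps ! j))"
  have xG: "x \<in> pverts G" using x j primary_verts by blast
  have D: "pverts D = pverts G" "parcs D = parcs G - ({x} \<times> pverts (Ps ! j) \<union> pverts (Ps ! j) \<times> {x})"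
    by (auto simp: D_def delete_edges_to_def)
  have wf: "wf_digraph (with_proj D)"
    by unfold_locales (use D arc_verts[OF connected] in auto)
  have "reachable (with_proj D) x v \<longleftrightarrow> v \<in> fibre j x" for v
  proof
    assume "reachable (with_proj D) x v"
    then show "v \<in> fibre j x"
    proof (induction rule: wf_digraph.reachable_induct[OF wf, consumes 1])
      case 1
      then show ?case using gate_id j x xG by (simp add: fibre_def)
    next
      case (2 y z)
      then have yz: "(y, z) \<in> parcs D" "(y, z) \<in> parcs G" "g j y = x" by (auto simp: D fibre_def)
      obtain i where i: "i < length Ps" "(y, z) \<in> parcs (Ps ! i)"
        "y \<in> pverts (Ps ! i)" "z \<in> pverts (Ps ! i)"
        using yz(2) by (rule arc_primary)
      \<comment> \<open>If the arc belonged to \<open>Ps ! j\<close>, then \<open>y\<close> would be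
        its own gate \<open>x\<close>, and the arcs from \<open>x\<close> into \<open>Ps ! j\<close>
        are deleted in \<open>D\<close>.\<close>
      have "i \<noteq> j"
        using yz i gate_id[OF j, of y] by (auto simp: D)
      then show ?case
        using gate_arc[OF i(1) j _ i(2)] yz primary_verts[OF i(1,4)] by (simp add: fibre_def)
    qed
  next
    assume v: "v \<in> fibre j x"
    then have "(x, v) \<in> (parcs G - parcs (Ps ! j))\<^sup>*"
      using gate_connected_avoiding_primary j by (auto simp: fibre_def)
    \<comment> \<open>A deleted arc has both ends in \<open>Ps ! j\<close> and hence is an arc of
      \<open>Ps ! j\<close>.\<close>
    moreover have "parcs G - parcs (Ps ! j) \<subseteq> parcs D"
      using arc_within_primary[OF j] x by (auto simp: D)
    ultimately have "(x, v) \<in> (parcs D)\<^sup>*" using rtrancl_mono by blast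
    then show "reachable (with_proj D) x v"
      unfolding reachable_def
      by (intro rtrancl_consistent_rtrancl_on)
        (use v xG D arc_verts[OF connected] in \<open>auto simp: fibre_def\<close>)
  qed
  then have "Collect (reachable (with_proj D) x) = fibre j x"
    by blast
  \<comment> \<open>The fibre contains no vertex of \<open>Ps ! j\<close> except \<open>x\<close>,
    so a deleted arc inside it would be a loop.\<close>
  moreover have "(x, x) \<notin> parcs G"
    using arc_neq[OF connected, of x x] by blast
  then have "parcs D \<inter> fibre j x \<times> fibre j x = parcs G \<inter> fibre j x \<times> fibre j x"
    using gate_id[OF j] by (auto simp: D fibre_def)
  ultimately show ?thesis
    unfolding plus_component_def component_of_def Let_def D_def[symmetric] by simp
qed

section \<open>Non-bipartite fibres and the sets \<open>C_set\<close>\<close>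

text \<open>By \<open>dist_through_gate\<close>, both distances arise from distances in
  \<open>Ps ! i\<close> to the gate of \<open>x\<close> by adding the same number, which preserves
  opposite parity.\<close>

lemma dist_parity_bipartite_primary:
  assumes "i < length Ps" "bipartite (Ps ! i)" "(a, b) \<in> parcs (Ps ! i)" "x \<in> pverts G"
  shows "even (graph_dist G a x) \<longleftrightarrow> odd (graph_dist G b x)"
proof -
  have "a \<in> pverts (Ps ! i)" "b \<in> pverts (Ps ! i)"
    using arc_verts[OF primary[OF assms(1)] assms(3)] by simp_all
  then show ?thesis
    using bipartite_dist_parity[OF primary[OF assms(1)] assms(2,3) gate_mem[OF assms(1,4)]]
      dist_through_gate[OF assms(1) _ assms(4)] by auto
qed

text \<open>Distances are measured in \<open>G\<close> even when the graph being coloured is only a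
  part of it.\<close>

lemma bipartite_if_dist_parity:
  assumes "\<forall>(a, b)\<in>A. a \<in> V \<and> b \<in> V \<and> (even (graph_dist G a x) \<longleftrightarrow> odd (graph_dist G b x))"
  shows "bipartite \<lparr>pverts = V, parcs = A\<rparr>"
  unfolding bipartite_def
  by (intro exI[of _ "{v \<in> V. even (graph_dist G v x)}"] exI[of _ "{v \<in> V. odd (graph_dist G v x)}"])
    (use assms in auto)

lemma exists_nonbipartite_primary:
  assumes "\<not> bipartite G"
  shows "\<exists>i<length Ps. \<not> bipartite (Ps ! i)"
proof (rule ccontr)
  assume *: "\<not> ?thesis"
  obtain x where x: "x \<in> pverts G" using pverts_nonempty[OF connected] by blast
  have "\<forall>(a, b)\<in>parcs G. a \<in> pverts G \<and> b \<in> pverts G \<and>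
      (even (graph_dist G a x) \<longleftrightarrow> odd (graph_dist G b x))"
    using dist_parity_bipartite_primary x * arc_verts[OF connected] by (auto elim: arc_primary)
  then have "bipartite \<lparr>pverts = pverts G, parcs = parcs G\<rparr>"
    by (rule bipartite_if_dist_parity)
  then show False using assms by (simp add: bipartite_def)
qed

text \<open>Every arc inside the fibre comes from some other \<open>Ps ! i\<close>, which lies
  wholly in the fibre because its gate is constant. If all of these are bipartite, the parity of the
  distance to \<open>x\<close> colours them consistently; conversely a bipartition restricts to each
  of them.\<close>

lemma bipartite_plus_component_iff:
  assumes j: "j < length Ps" and x: "x \<in> pverts (Ps ! j)"
  shows "bipartite (plus_component G (Ps ! j) x) \<longleftrightarrow>
    (\<forall>i<length Ps. i \<noteq> j \<longrightarrow> pverts (Ps ! i) \<subseteq> fibre j x \<longrightarrow> bipartite (Ps ! i))"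
proof (intro iffI allI impI)
  fix i
  assume "bipartite (plus_component G (Ps ! j) x)" and i: "i < length Ps" "i \<noteq> j"
    and sub: "pverts (Ps ! i) \<subseteq> fibre j x"
  then obtain A B where AB: "A \<union> B = fibre j x" "A \<inter> B = {}"
    "\<forall>(u, v)\<in>parcs G \<inter> fibre j x \<times> fibre j x. (u \<in> A \<and> v \<in> B) \<or> (u \<in> B \<and> v \<in> A)"
    unfolding plus_component_eq[OF j x] bipartite_def by auto
  have "parcs (Ps ! i) \<subseteq> parcs G \<inter> fibre j x \<times> fibre j x"
    using primary_arcs[OF i(1)] arc_verts[OF primary[OF i(1)]] sub by auto
  then have "(u \<in> A \<and> v \<in> B) \<or> (u \<in> B \<and> v \<in> A)" if "(u, v) \<in> parcs (Ps ! i)" for u v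
    using AB(3) that by blast
  then show "bipartite (Ps ! i)"
    unfolding bipartite_def using AB(1,2) sub arc_verts[OF primary[OF i(1)]]
    by (intro exI[of _ "A \<inter> pverts (Ps ! i)"] exI[of _ "B \<inter> pverts (Ps ! i)"]) auto
next
  assume bip: "\<forall>i<length Ps. i \<noteq> j \<longrightarrow> pverts (Ps ! i) \<subseteq> fibre j x \<longrightarrow> bipartite (Ps ! i)"
  have "even (graph_dist G a x) \<longleftrightarrow> odd (graph_dist G b x)"
    if ab: "(a, b) \<in> parcs G" "a \<in> fibre j x" "b \<in> fibre j x" for a b
  proof -
    obtain i where i: "i < length Ps" "(a, b) \<in> parcs (Ps ! i)"
      "a \<in> pverts (Ps ! i)" "b \<in> pverts (Ps ! i)"
      using ab(1) by (rule arc_primary)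
    have "a \<noteq> b" using arc_neq[OF connected ab(1)] .
    then have "i \<noteq> j" using gate_id[OF j, of a] gate_id[OF j, of b] i ab by (auto simp: fibre_def)
    moreover from this have "pverts (Ps ! i) \<subseteq> fibre j x"
      using gate_const[OF i(1) j _ i(3)] ab(2) primary_verts[OF i(1)] by (auto simp: fibre_def)
    ultimately show ?thesis
      using bip dist_parity_bipartite_primary[OF i(1) _ i(2) primary_verts[OF j x]] i(1) by simp
  qed
  then show "bipartite (plus_component G (Ps ! j) x)"
    unfolding plus_component_eq[OF j x] by (intro bipartite_if_dist_parity[of _ _ x]) auto
qed

text \<open>Reduces membership to non-bipartite primary subgraphs hanging at \<open>x\<close>. The
  attachment condition follows because a vertex of \<open>Ps ! j\<close> in no other primary
  subgraph has a one-element fibre, whose graph has no arcs.\<close>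

lemma C_set_iff:
  assumes j: "j < length Ps"
  shows "x \<in> C_set G Ps j \<longleftrightarrow> x \<in> pverts (Ps ! j) \<and>
    (\<exists>i<length Ps. i \<noteq> j \<and> \<not> bipartite (Ps ! i) \<and> pverts (Ps ! i) \<subseteq> fibre j x)"
proof -
  have "x \<in> attachment_vertices Ps"
    if x: "x \<in> pverts (Ps ! j)" and nb: "\<not> bipartite (plus_component G (Ps ! j) x)"
  proof (rule ccontr)
    assume "x \<notin> attachment_vertices Ps"
    then have only: "i = j" if "i < length Ps" "x \<in> pverts (Ps ! i)" for i
      using that j x unfolding attachment_vertices_def by blast
    have "w = x" if "w \<in> fibre j x" for w
    proof -
      have "(x, w) \<in> (parcs G - parcs (Ps ! j))\<^sup>*"
        using gate_connected_avoiding_primary[OF j] that by (auto simp: fibre_def)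
      then show ?thesis
      \<comment> \<open>A walk of positive length avoiding the arcs of \<open>Ps ! j\<close> would
        begin with an arc of another primary subgraph containing \<open>x\<close>.\<close>
      proof (cases rule: converse_rtranclE)
        case (step y)
        then show ?thesis using only by (metis Diff_iff arc_primary)
      qed simp
    qed
    then have "parcs G \<inter> fibre j x \<times> fibre j x = {}"
      using arc_neq[OF connected] by blast
    then show False
      using nb unfolding plus_component_eq[OF j x] by (auto simp: bipartite_def)
  qed
  then show ?thesis
    unfolding C_set_def using bipartite_plus_component_iff[OF j] by blast
qed

text \<open>Move along a walk from \<open>a\<close> to \<open>w\<close>. At \<open>a\<close> the
  second alternative holds. An arc of \<open>Ps ! i\<close> restores the second alternative, an arc
  of \<open>Ps ! j\<close> restores the first, and any other arc changes neither gate.\<close>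

lemma gate_or_gate:
  assumes i: "i < length Ps" and j: "j < length Ps" and "i \<noteq> j"
    and a: "a \<in> pverts (Ps ! i)" and b: "b \<in> pverts (Ps ! j)" and w: "w \<in> pverts G"
  shows "g i w = g i b \<or> g j w = g j a"
proof -
  have "(a, w) \<in> (parcs G)\<^sup>*"
    using walk_exists[OF connected _ w] primary_verts[OF i a] by simp
  then show ?thesis
  proof (induction rule: rtrancl_induct)
    case (step y z)
    obtain l where l: "l < length Ps" "(y, z) \<in> parcs (Ps ! l)"
      "y \<in> pverts (Ps ! l)" "z \<in> pverts (Ps ! l)"
      using step.hyps(2) by (rule arc_primary)
    consider "l = i" | "l = j" | "l \<noteq> i" "l \<noteq> j" by blast
    then show ?case
    proof cases
      case 1
      then show ?thesis using gate_const[OF i j \<open>i \<noteq> j\<close> l(4)[unfolded 1] a] by simp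
    next
      case 2
      then show ?thesis using gate_const[OF j i _ l(4)[unfolded 2] b] \<open>i \<noteq> j\<close> by simp
    next
      case 3
      then show ?thesis using gate_arc[OF l(1) i _ l(2)] gate_arc[OF l(1) j _ l(2)] step.IH by simp
    qed
  qed simp
qed

section \<open>Bases and \<open>alpha\<close>\<close>

lemma finite_C_cards: "j < length Ps \<Longrightarrow> finite {card (C_set G Ps j \<inter> B) |B. local_metric_basis (Ps ! j) B}"
proof -
  assume j: "j < length Ps"
  have "{B. local_metric_basis (Ps ! j) B} \<subseteq> Pow (pverts (Ps ! j))"
    by (auto simp: local_metric_basis_def local_metric_generator_def)
  then have "finite {B. local_metric_basis (Ps ! j) B}"
    using finite_pverts[OF primary[OF j]] finite_subset by blast
  then show ?thesis by simp
qed

lemma card_C_le_alpha: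
  assumes "j < length Ps" "local_metric_basis (Ps ! j) B"
  shows "card (C_set G Ps j \<inter> B) \<le> alpha G Ps j"
  unfolding alpha_def using finite_C_cards[OF assms(1)] assms(2) by (auto intro: Max_ge)

lemma alpha_attained:
  assumes "j < length Ps"
  obtains B where "local_metric_basis (Ps ! j) B" "card (C_set G Ps j \<inter> B) = alpha G Ps j"
proof -
  have "alpha G Ps j \<in> {card (C_set G Ps j \<inter> B) |B. local_metric_basis (Ps ! j) B}"
    unfolding alpha_def
    by (rule Max_in) (use finite_C_cards[OF assms] local_metric_basis_exists[OF primary[OF assms]] in auto)
  then show ?thesis using that by auto
qed

lemma card_basis_minus_C:
  assumes "j < length Ps" "local_metric_basis (Ps ! j) B"
  shows "int (card (B - C_set G Ps j)) = int (local_metric_dim (Ps ! j)) - int (card (C_set G Ps j \<inter> B))"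
proof -
  have "finite B" "card B = local_metric_dim (Ps ! j)"
    using assms local_metric_generator_finite primary by (auto simp: local_metric_basis_def)
  then show ?thesis
    by (metis Int_commute card_Diff_subset_Int card_mono finite_Int inf_le1 of_nat_diff)
qed

section \<open>The lower bound\<close>

lemma generator_card_ge:
  assumes min: "\<forall>j<length Ps. \<forall>W. minimal_local_metric_generator (Ps ! j) W
      \<longrightarrow> card W = local_metric_dim (Ps ! j)"
    and W: "local_metric_generator G W"
  shows "(\<Sum>j\<in>J_set Ps. int (local_metric_dim (Ps ! j)) - int (alpha G Ps j)) \<le> int (card W)"
proof -
  have WG: "W \<subseteq> pverts G" "finite W"
    using W local_metric_generator_finite[OF connected] by (auto simp: local_metric_generator_def)
  have "\<exists>B. B \<subseteq> g j ` W \<and> local_metric_basis (Ps ! j) B" if j: "j < length Ps" for j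
  proof -
    have "local_metric_generator (Ps ! j) (g j ` W)"
      using W generator_iff_gates[OF WG(1)] that by blast
    \<comment> \<open>Here the hypothesis on minimal generators enters: the minimal generator found
      among the gates is a basis.\<close>
    then obtain B where "B \<subseteq> g j ` W" "minimal_local_metric_generator (Ps ! j) B"
      using minimal_generator_exists[OF primary[OF j]] by metis
    then show ?thesis
      using min j by (auto simp: local_metric_basis_def minimal_local_metric_generator_def)
  qed
  then have "\<forall>j\<in>{..<length Ps}. \<exists>B. B \<subseteq> g j ` W \<and> local_metric_basis (Ps ! j) B"
    by simp
  from bchoice[OF this] obtain B
    where B: "\<And>j. j < length Ps \<Longrightarrow> B j \<subseteq> g j ` W \<and> local_metric_basis (Ps ! j) (B j)"
    by auto
  \<comment> \<open>Pairs are used so that \<open>card D\<close> is the sum to be bounded;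
    \<open>f\<close> picks for each pair a vertex of \<open>W\<close> with the prescribed
    gate.\<close>
  define D where "D = Sigma (J_set Ps) (\<lambda>j. B j - C_set G Ps j)"
  have "\<exists>w\<in>W. g j w = x" if "(j, x) \<in> D" for j x
    using that B[of j] by (auto simp: D_def J_set_def)
  then have "\<forall>p\<in>D. \<exists>w. w \<in> W \<and> g (fst p) w = snd p"
    by (metis prod.collapse)
  from bchoice[OF this] obtain f where "\<forall>p\<in>D. f p \<in> W \<and> g (fst p) (f p) = snd p"
    by blast
  then have f: "f (j, x) \<in> W \<and> g j (f (j, x)) = x" if "(j, x) \<in> D" for j x
    using that by force
  \<comment> \<open>The gate of one vertex of \<open>Ps ! i\<close> is the gate of all of them, so a
    non-bipartite \<open>Ps ! i\<close> hangs at \<open>x\<close>.\<close>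
  have in_C: "x \<in> C_set G Ps j"
    if "j \<in> J_set Ps" "i \<in> J_set Ps" "i \<noteq> j" "a \<in> pverts (Ps ! i)" "g j a = x" for i j a x
  proof -
    have ij: "i < length Ps" "j < length Ps" "\<not> bipartite (Ps ! i)"
      using that(1,2) by (auto simp: J_set_def)
    have "pverts (Ps ! i) \<subseteq> fibre j x"
      unfolding fibre_def
      using gate_const[OF ij(1,2) that(3) _ that(4)] that(5) primary_verts[OF ij(1)] by blast
    moreover have "x \<in> pverts (Ps ! j)"
      using gate_mem[OF ij(2) primary_verts[OF ij(1) that(4)]] that(5) by simp
    ultimately show ?thesis
      using C_set_iff[OF ij(2)] ij that(3) by blast
  qed
  have "inj_on f D"
  proof (rule inj_onI, clarify)
    fix j x i y
    assume jx: "(j, x) \<in> D" and iy: "(i, y) \<in> D" and eq: "f (j, x) = f (i, y)"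
    have J: "j \<in> J_set Ps" "i \<in> J_set Ps" and n: "j < length Ps" "i < length Ps"
      using jx iy by (auto simp: D_def J_set_def)
    have "j = i"
    proof (rule ccontr)
      assume "j \<noteq> i"
      obtain a b where ab: "a \<in> pverts (Ps ! i)" "b \<in> pverts (Ps ! j)"
        using pverts_nonempty[OF primary] n by blast
      have "f (j, x) \<in> pverts G" using f[OF jx] WG by blast
      \<comment> \<open>The common value of \<open>f\<close> has gates \<open>x\<close> and
        \<open>y\<close>, so one of these faces the other primary subgraph; by \<open>in_C\<close>
        it was excluded from \<open>D\<close>.\<close>
      then have "g i b = y \<or> g j a = x"
        using gate_or_gate[OF n(2,1) _ ab, of "f (j, x)"] f[OF jx] f[OF iy] eq \<open>j \<noteq> i\<close> by auto
      then have "y \<in> C_set G Ps i \<or> x \<in> C_set G Ps j"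
        using in_C[OF J(2,1) _ ab(2)] in_C[OF J _ ab(1)] \<open>j \<noteq> i\<close> by blast
      then show False using jx iy by (auto simp: D_def)
    qed
    then show "j = i \<and> x = y" using f[OF jx] f[OF iy] eq by metis
  qed
  then have "card D \<le> card W"
    using f WG(2) by (intro card_inj_on_le[of f]) auto
  moreover have "finite (B j)" if "j \<in> J_set Ps" for j
    using B local_metric_generator_finite[OF primary] that
    by (auto simp: J_set_def local_metric_basis_def)
  then have "card D = (\<Sum>j\<in>J_set Ps. card (B j - C_set G Ps j))"
    unfolding D_def by (intro card_SigmaI) (auto simp: J_set_def)
  then have "int (card D) = (\<Sum>j\<in>J_set Ps. int (card (B j - C_set G Ps j)))"
    by simp
  \<comment> \<open>The bases \<open>B j\<close> are dictated by \<open>W\<close> and may fall short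
    of \<open>alpha\<close>, which only enlarges the right-hand side.\<close>
  moreover have "(\<Sum>j\<in>J_set Ps. int (local_metric_dim (Ps ! j)) - int (alpha G Ps j))
      \<le> (\<Sum>j\<in>J_set Ps. int (card (B j - C_set G Ps j)))"
  proof (rule sum_mono)
    fix j
    assume "j \<in> J_set Ps"
    then have "j < length Ps" "local_metric_basis (Ps ! j) (B j)"
      using B by (simp_all add: J_set_def)
    then show "int (local_metric_dim (Ps ! j)) - int (alpha G Ps j) \<le> int (card (B j - C_set G Ps j))"
      using card_basis_minus_C[of j "B j"] card_C_le_alpha[of j "B j"] by simp
  qed
  ultimately show ?thesis by linarith
qed

section \<open>The upper bound\<close>

text \<open>Induction on the size of the fibre realises the descent to an outermost non-bipartite
  primary subgraph: each step passes to a fibre pointing further away from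
  \<open>Ps ! j\<close>.\<close>

lemma fibre_meets_union:
  assumes B: "\<And>j. j \<in> J_set Ps \<Longrightarrow> local_metric_basis (Ps ! j) (B j)"
    and W: "W = (\<Union>j\<in>J_set Ps. B j - C_set G Ps j)"
  shows "\<lbrakk>j < length Ps; x \<in> C_set G Ps j\<rbrakk> \<Longrightarrow> W \<inter> fibre j x \<noteq> {}"
proof (induction "card (fibre j x)" arbitrary: j x rule: less_induct)
  case less
  note j = less.prems(1)
  obtain i where i: "i < length Ps" "i \<noteq> j" "\<not> bipartite (Ps ! i)" "pverts (Ps ! i) \<subseteq> fibre j x"
    using less.prems C_set_iff by blast
  then have iJ: "i \<in> J_set Ps" by (simp add: J_set_def)
  obtain b where b: "b \<in> pverts (Ps ! j)"
    using pverts_nonempty[OF primary[OF j]] by blast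
  \<comment> \<open>\<open>y\<close> is the vertex of \<open>Ps ! i\<close> facing
    \<open>Ps ! j\<close>.\<close>
  define y where "y = g i b"
  have y: "y \<in> pverts (Ps ! i)" using gate_mem i(1) primary_verts[OF j b] by (simp add: y_def)
  show ?case
  proof (cases "\<exists>z\<in>C_set G Ps i. z \<noteq> y")
    case True
    then obtain z where z: "z \<in> C_set G Ps i" "z \<noteq> y" by blast
    have sub: "fibre i z \<subseteq> fibre j x"
    proof
      fix w
      assume w: "w \<in> fibre i z"
      \<comment> \<open>Since \<open>w\<close> does not see \<open>Ps ! i\<close> through
        \<open>y\<close>, it must see \<open>Ps ! j\<close> through the gate of
        \<open>Ps ! i\<close>, which is \<open>x\<close>.\<close>
      then have "g i w \<noteq> g i b" using z(2) by (auto simp: fibre_def y_def)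
      then have "g j w = g j y"
        using gate_or_gate[OF i(1) j i(2) y b] w by (auto simp: fibre_def)
      then show "w \<in> fibre j x" using w y i(4) by (auto simp: fibre_def)
    qed
    moreover have "y \<in> fibre j x" "y \<notin> fibre i z"
      using y i z(2) gate_id by (auto simp: fibre_def)
    ultimately have "fibre i z \<subset> fibre j x" by blast
    moreover have "finite (fibre j x)"
      using finite_pverts[OF connected] by (simp add: fibre_def)
    ultimately have "W \<inter> fibre i z \<noteq> {}"
      using less.hyps[of i z] i(1) z(1) psubset_card_mono by blast
    then show ?thesis using sub by blast
  next
    case False
    have gen: "local_metric_generator (Ps ! i) (B i)"
      using B[OF iJ] by (simp add: local_metric_basis_def)
    \<comment> \<open>In this case \<open>C_set G Ps i\<close> contains at most \<open>y\<close>, so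
      any other element of the basis survives in \<open>W\<close>.\<close>
    then have "\<not> B i \<subseteq> {y}"
      using not_bipartite_generator_not_singleton[OF primary[OF i(1)] i(3)] by blast
    then obtain z where "z \<in> B i - C_set G Ps i" using False by blast
    then have "z \<in> W" "z \<in> pverts (Ps ! i)"
      using gen iJ W by (auto simp: local_metric_generator_def)
    then show ?thesis using i(4) by blast
  qed
qed

lemma local_metric_dim_le_alpha_sum:
  assumes nb: "\<not> bipartite G"
  shows "int (local_metric_dim G) \<le> (\<Sum>j\<in>J_set Ps. int (local_metric_dim (Ps ! j)) - int (alpha G Ps j))"
proof -
  have "\<forall>j\<in>{..<length Ps}. \<exists>B. local_metric_basis (Ps ! j) B \<and> card (C_set G Ps j \<inter> B) = alpha G Ps j"
    by (auto elim: alpha_attained)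
  from bchoice[OF this] obtain B where B: "\<And>j. j < length Ps \<Longrightarrow>
      local_metric_basis (Ps ! j) (B j) \<and> card (C_set G Ps j \<inter> B j) = alpha G Ps j"
    by auto
  then have basis: "local_metric_basis (Ps ! j) (B j)" if "j \<in> J_set Ps" for j
    using that by (simp add: J_set_def)
  have BP: "B j \<subseteq> pverts (Ps ! j)" if "j < length Ps" for j
    using B[OF that] by (auto simp: local_metric_basis_def local_metric_generator_def)
  define W where "W = (\<Union>j\<in>J_set Ps. B j - C_set G Ps j)"
  have WG: "W \<subseteq> pverts G"
    unfolding W_def J_set_def using BP pverts_eq by blast
  have meets: "W \<inter> fibre j x \<noteq> {}" if "j < length Ps" "x \<in> C_set G Ps j" for j x
    using fibre_meets_union[OF basis W_def that] by blast
  \<comment> \<open>Nonemptiness serves the bipartite primary subgraphs, to which \<open>W\<close>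
    contributes only gates.\<close>
  have "W \<noteq> {}"
  proof -
    obtain i where i: "i < length Ps" "\<not> bipartite (Ps ! i)"
      using exists_nonbipartite_primary[OF nb] by blast
    \<comment> \<open>The vertex \<open>undefined\<close> is arbitrary; only an element of
      \<open>B i\<close> is wanted.\<close>
    then have "\<not> B i \<subseteq> {undefined}"
      using not_bipartite_generator_not_singleton[OF primary] B by (auto simp: local_metric_basis_def)
    then obtain x where "x \<in> B i" by blast
    then show ?thesis
      using meets[of i x] i by (cases "x \<in> C_set G Ps i") (auto simp: W_def J_set_def)
  qed
  have "local_metric_generator (Ps ! j) (g j ` W)" if j: "j < length Ps" for j
  proof (cases "bipartite (Ps ! j)")
    case True
    \<comment> \<open>By parity, a single gate resolves all edges of a bipartite primary
      subgraph.\<close>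
    obtain w where w: "w \<in> W" using \<open>W \<noteq> {}\<close> by blast
    then have "g j w \<in> pverts (Ps ! j)" using gate_mem j WG by blast
    then have "graph_dist (Ps ! j) u (g j w) \<noteq> graph_dist (Ps ! j) v (g j w)"
      if "(u, v) \<in> parcs (Ps ! j)" for u v
      using bipartite_dist_parity[OF primary[OF j] True that] by metis
    then show ?thesis
      unfolding local_metric_generator_def using w gate_mem[OF j] WG by blast
  next
    case False
    \<comment> \<open>Elements outside \<open>C_set G Ps j\<close> lie in \<open>W\<close> and are
      their own gates; the others are gates of vertices of \<open>W\<close> in their fibres.\<close>
    have "B j \<subseteq> g j ` W"
    proof
      fix x
      assume x: "x \<in> B j"
      show "x \<in> g j ` W"
      proof (cases "x \<in> C_set G Ps j")
        case True
        then show ?thesis using meets[OF j] by (auto simp: fibre_def)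
      next
        case f: False
        then have "x \<in> W" using x j False by (auto simp: W_def J_set_def)
        then show ?thesis using gate_id[OF j] BP[OF j] x by (metis image_eqI subsetD)
      qed
    qed
    moreover have "g j ` W \<subseteq> pverts (Ps ! j)" using gate_mem[OF j] WG by blast
    ultimately show ?thesis
      using B[OF j] local_metric_generator_superset by (auto simp: local_metric_basis_def)
  qed
  then have "local_metric_generator G W" using generator_iff_gates[OF WG] by blast
  then have "local_metric_dim G \<le> card W" by (rule local_metric_dim_le[OF connected])
  also have "\<dots> \<le> (\<Sum>j\<in>J_set Ps. card (B j - C_set G Ps j))"
    unfolding W_def by (rule card_UN_le) (simp add: J_set_def)
  finally have "int (local_metric_dim G) \<le> (\<Sum>j\<in>J_set Ps. int (card (B j - C_set G Ps j)))"
    by (metis of_nat_le_iff of_nat_sum)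
  also have "\<dots> = (\<Sum>j\<in>J_set Ps. int (local_metric_dim (Ps ! j)) - int (alpha G Ps j))"
    using B card_basis_minus_C by (intro sum.cong) (auto simp: J_set_def)
  finally show ?thesis .
qed

lemma local_metric_dim_eq:
  assumes "\<not> bipartite G"
    and "\<forall>j<length Ps. \<forall>W. minimal_local_metric_generator (Ps ! j) W
      \<longrightarrow> card W = local_metric_dim (Ps ! j)"
  shows "int (local_metric_dim G) =
    (\<Sum>j\<in>J_set Ps. int (local_metric_dim (Ps ! j)) - int (alpha G Ps j))"
proof -
  obtain W where "local_metric_generator G W" "card W = local_metric_dim G"
    using local_metric_basis_exists[OF connected] by (auto simp: local_metric_basis_def)
  then show ?thesis
    using generator_card_ge[OF assms(2)] local_metric_dim_le_alpha_sum[OF assms(1)] by fastforce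
qed

end

section \<open>Renaming vertices and point-attaching\<close>

context
  fixes H :: "'a pair_pre_digraph" and f :: "'a \<Rightarrow> 'b"
  assumes H: "connected_graph H" and inj: "inj_on f (pverts H)"
begin

lemma parcs_map_graph_iff:
  assumes "a \<in> pverts H" "b \<in> pverts H"
  shows "(f a, f b) \<in> parcs (map_graph f H) \<longleftrightarrow> (a, b) \<in> parcs H"
proof
  assume "(f a, f b) \<in> parcs (map_graph f H)"
  then obtain c d where "(c, d) \<in> parcs H" "f a = f c" "f b = f d"
    by (auto simp: map_graph_def)
  then show "(a, b) \<in> parcs H"
    using assms arc_verts[OF H] inj by (metis inj_onD)
qed (force simp: map_graph_def)

text \<open>Every vertex of a walk in the image has a preimage in \<open>H\<close>, and injectivity
  makes the lifted arcs fit together.\<close>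

lemma relpow_map_graph_iff:
  assumes "a \<in> pverts H" "b \<in> pverts H"
  shows "(f a, f b) \<in> parcs (map_graph f H) ^^ n \<longleftrightarrow> (a, b) \<in> parcs H ^^ n"
  using assms(2)
proof (induction n arbitrary: b)
  case 0
  then show ?case using assms(1) inj by (auto dest: inj_onD)
next
  case (Suc n)
  show ?case
  proof
    assume "(f a, f b) \<in> parcs (map_graph f H) ^^ Suc n"
    then obtain z where z: "(f a, z) \<in> parcs (map_graph f H) ^^ n" "(z, f b) \<in> parcs (map_graph f H)"
      by auto
    then obtain c where "c \<in> pverts H" "z = f c"
      using arc_verts[OF H] by (auto simp: map_graph_def)
    then show "(a, b) \<in> parcs H ^^ Suc n"
      using z Suc parcs_map_graph_iff by auto
  next
    assume "(a, b) \<in> parcs H ^^ Suc n"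
    then obtain c where "(a, c) \<in> parcs H ^^ n" "(c, b) \<in> parcs H" by auto
    then show "(f a, f b) \<in> parcs (map_graph f H) ^^ Suc n"
      using Suc parcs_map_graph_iff arc_verts[OF H] by (metis relpow_Suc_I)
  qed
qed

lemma connected_graph_map_graph: "connected_graph (map_graph f H)"
  unfolding connected_graph_def
proof (intro conjI ballI)
  show "finite (pverts (map_graph f H))" "pverts (map_graph f H) \<noteq> {}"
    using H by (auto simp: map_graph_def connected_graph_def)
  show "parcs (map_graph f H) \<subseteq> pverts (map_graph f H) \<times> pverts (map_graph f H)"
    using arc_verts[OF H] by (auto simp: map_graph_def)
  show "sym (parcs (map_graph f H))"
    using arc_sym[OF H] by (force simp: map_graph_def sym_def)
  show "irrefl (parcs (map_graph f H))"
    using arc_neq[OF H] arc_verts[OF H] inj_onD[OF inj] by (fastforce simp: map_graph_def irrefl_def)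
  fix x y
  assume "x \<in> pverts (map_graph f H)" "y \<in> pverts (map_graph f H)"
  then obtain a b where ab: "x = f a" "y = f b" "a \<in> pverts H" "b \<in> pverts H"
    by (auto simp: map_graph_def)
  then have "(a, b) \<in> (parcs H)\<^sup>*" using walk_exists[OF H] by blast
  then show "(x, y) \<in> (parcs (map_graph f H))\<^sup>*"
    using ab relpow_map_graph_iff by (metis rtrancl_imp_relpow relpow_imp_rtrancl)
qed

lemma graph_dist_map_graph:
  assumes "a \<in> pverts H" "b \<in> pverts H"
  shows "graph_dist (map_graph f H) (f a) (f b) = graph_dist H a b"
proof -
  have "f a \<in> pverts (map_graph f H)" "f b \<in> pverts (map_graph f H)"
    using assms by (auto simp: map_graph_def)
  then show ?thesis
    using graph_dist_relpow[OF H assms] graph_dist_relpow[OF connected_graph_map_graph]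
      relpow_map_graph_iff[OF assms] by (meson antisym)
qed

lemma local_metric_generator_map_graph:
  assumes "W \<subseteq> pverts H"
  shows "local_metric_generator (map_graph f H) (f ` W) \<longleftrightarrow> local_metric_generator H W"
proof -
  have "(\<exists>w\<in>f ` W. graph_dist (map_graph f H) (f a) w \<noteq> graph_dist (map_graph f H) (f b) w)
      \<longleftrightarrow> (\<exists>w\<in>W. graph_dist H a w \<noteq> graph_dist H b w)" if "(a, b) \<in> parcs H" for a b
    using that graph_dist_map_graph arc_verts[OF H] assms by (auto simp: subset_iff)
  then show ?thesis
    using assms unfolding local_metric_generator_def by (fastforce simp: map_graph_def)
qed

lemma local_metric_generator_map_graphE:
  assumes "local_metric_generator (map_graph f H) W'"
  obtains W where "W \<subseteq> pverts H" "W' = f ` W" "local_metric_generator H W" "card W' = card W"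
proof -
  have "W' \<subseteq> f ` pverts H"
    using assms by (simp add: local_metric_generator_def map_graph_def)
  then obtain W where W: "W \<subseteq> pverts H" "W' = f ` W" by (meson subset_imageE)
  then show ?thesis
    using that assms local_metric_generator_map_graph inj by (metis card_image inj_on_subset)
qed

lemma local_metric_dim_map_graph: "local_metric_dim (map_graph f H) = local_metric_dim H"
proof -
  have "(\<exists>W. local_metric_generator (map_graph f H) W \<and> card W = n)
      \<longleftrightarrow> (\<exists>W. local_metric_generator H W \<and> card W = n)" for n
  proof
    assume "\<exists>W. local_metric_generator H W \<and> card W = n"
    then obtain W where W: "local_metric_generator H W" "card W = n" by blast
    then have "W \<subseteq> pverts H" by (simp add: local_metric_generator_def)
    then show "\<exists>W. local_metric_generator (map_graph f H) W \<and> card W = n"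
      using W local_metric_generator_map_graph inj by (metis card_image inj_on_subset)
  qed (metis local_metric_generator_map_graphE)
  then show ?thesis unfolding local_metric_dim_def by presburger
qed

lemma minimal_local_metric_generator_map_graphE:
  assumes "minimal_local_metric_generator (map_graph f H) W'"
  obtains W where "minimal_local_metric_generator H W" "card W' = card W"
proof -
  obtain W where W: "W \<subseteq> pverts H" "W' = f ` W" "local_metric_generator H W" "card W' = card W"
    using assms local_metric_generator_map_graphE unfolding minimal_local_metric_generator_def by metis
  have "\<not> local_metric_generator H V" if "V \<subset> W" for V
  proof -
    have "f ` V \<subset> f ` W" using that W(1) inj by (meson image_strict_mono inj_on_subset)
    then show ?thesis
      using assms W(1,2) that local_metric_generator_map_graph[of V]
      unfolding minimal_local_metric_generator_def by blast
  qed
  then have "minimal_local_metric_generator H W"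
    using W(3) by (simp add: minimal_local_metric_generator_def)
  then show ?thesis using that W(4) by blast
qed

lemma bipartite_map_graph: "bipartite (map_graph f H) \<longleftrightarrow> bipartite H"
proof -
  obtain y where y: "y \<in> pverts H" using pverts_nonempty[OF H] by blast
  then have fy: "f y \<in> pverts (map_graph f H)" by (simp add: map_graph_def)
  have "graph_dist (map_graph f H) (f u) (f y) = graph_dist (map_graph f H) (f v) (f y)
      \<longleftrightarrow> graph_dist H u y = graph_dist H v y" if "(u, v) \<in> parcs H" for u v
    using that arc_verts[OF H] graph_dist_map_graph y by auto
  then show ?thesis
    unfolding bipartite_iff_resolving_vertex[OF H y]
      bipartite_iff_resolving_vertex[OF connected_graph_map_graph fy]
    by (fastforce simp: map_graph_def)
qed

end

section \<open>Gates of a graph obtained by point-attaching\<close>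

text \<open>The gates are built along the construction. The bound on \<open>pverts G\<close> keeps
  the next graph \<open>H\<close> disjoint from \<open>G\<close> during the induction.\<close>

lemma point_attaching_gated:
  assumes "point_attaching Gs G Ps"
    and "\<forall>j<length Gs. connected_graph (Gs ! j)"
    and "\<forall>i<length Gs. \<forall>j<length Gs. i \<noteq> j \<longrightarrow> pverts (Gs ! i) \<inter> pverts (Gs ! j) = {}"
  shows "length Ps = length Gs \<and> pverts G \<subseteq> (\<Union>j<length Gs. pverts (Gs ! j)) \<and> (\<exists>g. gated_union G Ps g) \<and>
    (\<forall>j<length Gs. \<exists>f. inj_on f (pverts (Gs ! j)) \<and> Ps ! j = map_graph f (Gs ! j))"
  using assms
proof (induction rule: point_attaching.induct)
  case (start G)
  \<comment> \<open>With one primary subgraph every vertex is its own gate, and the condition on two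
    distinct indices is vacuous.\<close>
  have "gated_union G [G] (\<lambda>_ w. w)"
    using start by unfold_locales auto
  moreover have "G = map_graph id G" by (simp add: map_graph_def map_prod.id)
  ultimately show ?case by (auto intro!: exI[of _ id])
next
  case (attach Gs G Ps u v H H')
  let ?n = "length Gs"
  have old: "(Gs @ [H]) ! j = Gs ! j" if "j < ?n" for j
    using that by (simp add: nth_append)
  have new: "(Gs @ [H]) ! ?n = H" by simp
  have conn: "\<forall>j<?n. connected_graph (Gs ! j)" and H: "connected_graph H"
    using attach.prems(1) old new by (metis length_append_singleton less_SucI, metis length_append_singleton lessI)
  have "\<forall>i<?n. \<forall>j<?n. i \<noteq> j \<longrightarrow> pverts (Gs ! i) \<inter> pverts (Gs ! j) = {}"
  proof (intro allI impI)
    fix i j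
    assume "i < ?n" "j < ?n" "i \<noteq> j"
    then show "pverts (Gs ! i) \<inter> pverts (Gs ! j) = {}"
      using attach.prems(2)[rule_format, of i j] old by simp
  qed
  note IH_conj = attach.IH[OF conn this]
  note IH = IH_conj[THEN conjunct1] IH_conj[THEN conjunct2, THEN conjunct1]
    IH_conj[THEN conjunct2, THEN conjunct2, THEN conjunct1]
    IH_conj[THEN conjunct2, THEN conjunct2, THEN conjunct2]
  have disj: "pverts (Gs ! j) \<inter> pverts H = {}" if "j < ?n" for j
    using attach.prems(2)[rule_format, of j ?n] that old by simp
  then have GH: "pverts G \<inter> pverts H = {}" using IH(2) by blast
  \<comment> \<open>The new name \<open>u\<close> lies in \<open>G\<close>, hence outside
    \<open>H\<close>, and so collides with no vertex of \<open>H\<close>.\<close>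
  have inj: "inj_on (id(v := u)) (pverts H)"
    using GH attach.hyps by (auto simp: inj_on_def)
  have H': "connected_graph H'"
    using connected_graph_map_graph[OF H inj] attach.hyps by simp
  have vH': "pverts H' = insert u (pverts H - {v})"
    using attach.hyps by (auto simp: map_graph_def)
  then have meet: "pverts G \<inter> pverts H' = {u}" using GH attach.hyps by auto
  obtain g where "gated_union G Ps g" using IH(3) by blast
  then interpret gated_union G Ps g .
  \<comment> \<open>Old and new vertices see each other only through \<open>u\<close>: the new ones
    inherit its gates in the old primary subgraphs, and the old ones have gate \<open>u\<close> in
    \<open>H'\<close>. At \<open>u\<close> itself the rules agree.\<close>
  define g' where "g' j w = (if j < ?n then if w \<in> pverts G then g j w else g j u
      else if w \<in> pverts H' then w else u)" for j w
  have nth: "(Ps @ [H']) ! j = (if j < ?n then Ps ! j else H')" if "j < Suc ?n" for j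
    using that IH(1) by (auto simp: nth_append)
  have sub: "pverts (Ps ! j) \<subseteq> pverts G" if "j < ?n" for j
    using that IH(1) primary_verts by auto
  have g'G: "g' j w = g j w" if "j < ?n" "w \<in> pverts G" for j w
    using that by (simp add: g'_def)
  have g'H: "g' j w = g j u" if "j < ?n" "w \<in> pverts H'" for j w
    using that meet by (auto simp: g'_def)
  have g'nG: "g' ?n w = u" if "w \<in> pverts G" for w
    using that meet by (auto simp: g'_def)
  have g'nH: "g' ?n w = w" if "w \<in> pverts H'" for w
    using that by (simp add: g'_def)
  have un: "pverts (graph_union G H') = pverts G \<union> pverts H'" "parcs (graph_union G H') = parcs G \<union> parcs H'"
    by (simp_all add: graph_union_def)
  have len: "length (Ps @ [H']) = Suc ?n" using IH(1) by simp
  have "gated_union (graph_union G H') (Ps @ [H']) g'"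
  proof
    show "connected_graph (graph_union G H')"
      unfolding connected_graph_def un
    proof (intro conjI ballI)
      show "finite (pverts G \<union> pverts H')" "pverts G \<union> pverts H' \<noteq> {}"
        "parcs G \<union> parcs H' \<subseteq> (pverts G \<union> pverts H') \<times> (pverts G \<union> pverts H')"
        "sym (parcs G \<union> parcs H')" "irrefl (parcs G \<union> parcs H')"
        using connected H' by (auto simp: connected_graph_def sym_Un irrefl_def)
      \<comment> \<open>The shared vertex \<open>u\<close> serves as a hub joining the two connected
        parts.\<close>
      have to_u: "(x, u) \<in> (parcs G \<union> parcs H')\<^sup>* \<and> (u, x) \<in> (parcs G \<union> parcs H')\<^sup>*"
        if "x \<in> pverts G \<union> pverts H'" for x
        using that walk_exists[OF connected, of x u] walk_exists[OF connected, of u x]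
          walk_exists[OF H', of x u] walk_exists[OF H', of u x] attach.hyps(2) meet
          rtrancl_mono[of "parcs G" "parcs G \<union> parcs H'"] rtrancl_mono[of "parcs H'" "parcs G \<union> parcs H'"]
        by blast
      show "(x, y) \<in> (parcs G \<union> parcs H')\<^sup>*"
        if "x \<in> pverts G \<union> pverts H'" "y \<in> pverts G \<union> pverts H'" for x y
        using to_u that by (meson rtrancl_trans)
    qed
  next
    show "connected_graph ((Ps @ [H']) ! j)" if "j < length (Ps @ [H'])" for j
      using that nth primary H' IH(1) len by auto
  next
    show "pverts (graph_union G H') = (\<Union>j<length (Ps @ [H']). pverts ((Ps @ [H']) ! j))"
      unfolding len lessThan_Suc un pverts_eq IH(1) by (auto simp: nth)
    show "parcs (graph_union G H') = (\<Union>j<length (Ps @ [H']). parcs ((Ps @ [H']) ! j))"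
      unfolding len lessThan_Suc un parcs_eq IH(1) by (auto simp: nth)
  next
    fix j w
    assume j: "j < length (Ps @ [H'])"
    show "g' j w \<in> pverts ((Ps @ [H']) ! j)" if "w \<in> pverts (graph_union G H')"
      using that j gate_mem[of j] attach.hyps(2) meet nth[of j] IH(1) unfolding len un
      by (auto simp: g'_def)
    show "g' j w = w" if "w \<in> pverts ((Ps @ [H']) ! j)"
      using that j gate_id[of j] sub[of j] nth[of j] IH(1) unfolding len
      by (auto simp: g'_def split: if_splits)
  next
    fix i j a b
    assume ij: "i < length (Ps @ [H'])" "j < length (Ps @ [H'])" "i \<noteq> j"
      and ab: "(a, b) \<in> parcs ((Ps @ [H']) ! i)"
    consider "i < ?n" "j < ?n" | "i = ?n" "j < ?n" | "i < ?n" "j = ?n"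
      using ij unfolding len by linarith
    then show "g' j a = g' j b"
    proof cases
      case 1
      then have "(a, b) \<in> parcs (Ps ! i)" using ab nth by simp
      moreover from this have "a \<in> pverts G" "b \<in> pverts G"
        using arc_verts[OF primary[of i], of a b] sub[of i] 1 IH(1) by auto
      ultimately show ?thesis using gate_arc[of i j] g'G 1 ij IH(1) by simp
    next
      case 2
      then have "(a, b) \<in> parcs H'" using ab nth by simp
      then show ?thesis using g'H 2 arc_verts[OF H'] by simp
    next
      case 3
      then have "(a, b) \<in> parcs (Ps ! i)" using ab nth by simp
      then have "a \<in> pverts G" "b \<in> pverts G"
        using arc_verts[OF primary[of i], of a b] sub[of i] 3 IH(1) by auto
      then show ?thesis using g'nG 3 by simp
    qed
  qed
  moreover have "pverts (graph_union G H') \<subseteq> (\<Union>j<length (Gs @ [H]). pverts ((Gs @ [H]) ! j))"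
    using IH(2) attach.hyps(2) vH' old unfolding un by (fastforce simp: lessThan_Suc)
  moreover have "\<exists>f. inj_on f (pverts ((Gs @ [H]) ! j)) \<and> (Ps @ [H']) ! j = map_graph f ((Gs @ [H]) ! j)"
    if "j < length (Gs @ [H])" for j
  proof (cases "j < ?n")
    case True
    then show ?thesis using IH(4) old nth by simp
  next
    case False
    then have "j = ?n" using that by simp
    then show ?thesis using inj attach.hyps(4) nth by auto
  qed
  ultimately show ?case using len by auto
qed

section \<open>Transfer from the primary subgraphs to the given family\<close>

theorem theorem4:
  fixes Gs Ps :: "'a pair_pre_digraph list" and G :: "'a pair_pre_digraph"
  assumes "\<forall>j < length Gs. pair_graph (Gs ! j) \<and>
      Digraph_Component.connected (with_proj (Gs ! j)) \<and> card (pverts (Gs ! j)) \<ge> 2"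
    and "\<forall>i < length Gs. \<forall>j < length Gs. i \<noteq> j \<longrightarrow> pverts (Gs ! i) \<inter> pverts (Gs ! j) = {}"
    and "point_attaching Gs G Ps"
    and "\<not> bipartite G"
    and "\<forall>j < length Gs. \<forall>W. minimal_local_metric_generator (Gs ! j) W
      \<longrightarrow> card W = local_metric_dim (Gs ! j)"
  shows "int (local_metric_dim G) =
    (\<Sum>j \<in> J_set Gs. int (local_metric_dim (Gs ! j)) - int (alpha G Ps j))"
proof -
  have conn: "\<forall>j<length Gs. connected_graph (Gs ! j)"
    using assms(1) pair_graph_connected_graph by blast
  obtain g where len: "length Ps = length Gs" and "gated_union G Ps g"
    and iso: "\<forall>j<length Gs. \<exists>f. inj_on f (pverts (Gs ! j)) \<and> Ps ! j = map_graph f (Gs ! j)"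
    using point_attaching_gated[OF assms(3) conn assms(2)] by blast
  then interpret gated_union G Ps g by blast
  have bip: "bipartite (Ps ! j) \<longleftrightarrow> bipartite (Gs ! j)"
    and dim: "local_metric_dim (Ps ! j) = local_metric_dim (Gs ! j)" if "j < length Gs" for j
    using that iso conn bipartite_map_graph local_metric_dim_map_graph by metis+
  \<comment> \<open>The hypothesis on minimal generators is carried over to the renamed
    graphs.\<close>
  have "card W = local_metric_dim (Ps ! j)"
    if j: "j < length Ps" and W: "minimal_local_metric_generator (Ps ! j) W" for j W
  proof -
    obtain f where "inj_on f (pverts (Gs ! j))" "Ps ! j = map_graph f (Gs ! j)"
      using iso j len by auto
    then obtain V where "minimal_local_metric_generator (Gs ! j) V" "card W = card V"
      using minimal_local_metric_generator_map_graphE W conn j len by metis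
    then show ?thesis using assms(5) dim j len by simp
  qed
  then have "int (local_metric_dim G) =
      (\<Sum>j\<in>J_set Ps. int (local_metric_dim (Ps ! j)) - int (alpha G Ps j))"
    using local_metric_dim_eq assms(4) by blast
  \<comment> \<open>Only the index set and the dimensions are translated; \<open>alpha\<close>
    already refers to the primary subgraphs.\<close>
  also have "\<dots> = (\<Sum>j\<in>J_set Gs. int (local_metric_dim (Gs ! j)) - int (alpha G Ps j))"
    using bip dim len by (intro sum.cong) (auto simp: J_set_def)
  finally show ?thesis .
qed

end
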